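(* There exist a Riemannian manifold $M$ and a constant $c<0$ such that the sectional curvature of $M$ assumes every real value greater than $c$ (that is, for every real $\kappa>c$ there are a point $x\in M$ and a two-dimensional subspace of $T_xM$ whose sectional curvature equals $\kappa$), and such that $M$ admits a strictly convex function $f:M\to\mathbb{R}$.
   Context: A function $f:M\to\mathbb{R}$ on a Riemannian manifold is strictly convex if for every non-constant geodesic segment $\gamma:[a,b]\to M$ with $a<b$ and every $t\in(0,1)$, $f(\gamma((1-t)a+tb))<(1-t)f(\gamma(a))+tf(\gamma(b))$. Geodesics here are all solutions of the geodesic equation, not only minimizing ones. *)

theory Defs
  imports "HOL-Analysis.Analysis"
begin

text \<open>Smooth functions on open subsets of \<open>\<real>\<^sup>n\<close>. Points of \<open>\<real>\<^sup>n\<close> are those of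
  \<^term>\<open>Euclidean_space n\<close>, i.e. sequences \<open>nat \<Rightarrow> real\<close> vanishing from index \<open>n\<close> on.\<close>

definition partial :: "nat \<Rightarrow> ((nat \<Rightarrow> real) \<Rightarrow> real) \<Rightarrow> (nat \<Rightarrow> real) \<Rightarrow> real" where
  "partial i f y = deriv (\<lambda>t. f (y(i := t))) (y i)"

fun C_k_on :: "nat \<Rightarrow> nat \<Rightarrow> (nat \<Rightarrow> real) set \<Rightarrow> ((nat \<Rightarrow> real) \<Rightarrow> real) \<Rightarrow> bool" where
  "C_k_on n 0 V f \<longleftrightarrow> continuous_map (subtopology (Euclidean_space n) V) euclideanreal f"
| "C_k_on n (Suc k) V f \<longleftrightarrow>
     continuous_map (subtopology (Euclidean_space n) V) euclideanreal f \<and>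
     (\<forall>i<n. (\<forall>y\<in>V. (\<lambda>t. f (y(i := t))) differentiable (at (y i))) \<and> C_k_on n k V (partial i f))"

definition smooth_on :: "nat \<Rightarrow> (nat \<Rightarrow> real) set \<Rightarrow> ((nat \<Rightarrow> real) \<Rightarrow> real) \<Rightarrow> bool" where
  "smooth_on n V f \<longleftrightarrow> (\<forall>k. C_k_on n k V f)"

text \<open>A chart is a coordinate domain together with its coordinate map, whose values outside the
  domain are irrelevant. A tangent vector is encoded by its coordinates in each chart: one
  coordinate vector per chart around the base point, related by the Jacobians of the transition
  maps (and, for uniqueness of the representation, \<open>0\<close> for all other pairs).\<close>

type_synonym 'a chart = "'a set \<times> ('a \<Rightarrow> nat \<Rightarrow> real)"
type_synonym 'a tangent = "'a chart \<Rightarrow> nat \<Rightarrow> real"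

record 'a riemannian =
  mtop :: "'a topology"
  mdim :: nat
  atlas :: "'a chart set"
  metric :: "'a \<Rightarrow> 'a tangent \<Rightarrow> 'a tangent \<Rightarrow> real"

abbreviation chart_dom :: "'a chart \<Rightarrow> 'a set" where "chart_dom c \<equiv> fst c"
abbreviation chart_map :: "'a chart \<Rightarrow> 'a \<Rightarrow> nat \<Rightarrow> real" where "chart_map c \<equiv> snd c"
abbreviation chart_img :: "'a chart \<Rightarrow> (nat \<Rightarrow> real) set" where
  "chart_img c \<equiv> chart_map c ` chart_dom c"

definition chart_inv :: "'a chart \<Rightarrow> (nat \<Rightarrow> real) \<Rightarrow> 'a" where
  "chart_inv c = inv_into (chart_dom c) (chart_map c)"

definition is_chart :: "'a topology \<Rightarrow> nat \<Rightarrow> 'a chart \<Rightarrow> bool" where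
  "is_chart X n c \<longleftrightarrow>
     openin X (chart_dom c) \<and> openin (Euclidean_space n) (chart_img c) \<and>
     homeomorphic_map (subtopology X (chart_dom c))
       (subtopology (Euclidean_space n) (chart_img c)) (chart_map c)"

definition transition :: "'a chart \<Rightarrow> 'a chart \<Rightarrow> nat \<Rightarrow> (nat \<Rightarrow> real) \<Rightarrow> real" where
  "transition c d k = (\<lambda>y. chart_map d (chart_inv c y) k)"

definition smooth_manifold :: "'a topology \<Rightarrow> nat \<Rightarrow> 'a chart set \<Rightarrow> bool" where
  "smooth_manifold X n A \<longleftrightarrow>
     Hausdorff_space X \<and> second_countable X \<and> connected_space X \<and>
     (\<forall>c\<in>A. is_chart X n c) \<and> (\<Union>c\<in>A. chart_dom c) = topspace X \<and>
     (\<forall>c\<in>A. \<forall>d\<in>A. \<forall>k<n.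
        smooth_on n (chart_map c ` (chart_dom c \<inter> chart_dom d)) (transition c d k))"

definition charts_at :: "('a, 'm) riemannian_scheme \<Rightarrow> 'a \<Rightarrow> 'a chart set" where
  "charts_at M x = {c \<in> atlas M. x \<in> chart_dom c}"

definition tangent_space :: "('a, 'm) riemannian_scheme \<Rightarrow> 'a \<Rightarrow> 'a tangent set" where
  "tangent_space M x =
     {v. (\<forall>c. c \<notin> charts_at M x \<longrightarrow> v c = (\<lambda>_. 0)) \<and>
         (\<forall>c\<in>charts_at M x. v c \<in> topspace (Euclidean_space (mdim M))) \<and>
         (\<forall>c\<in>charts_at M x. \<forall>d\<in>charts_at M x. \<forall>k<mdim M.
            v d k = (\<Sum>i<mdim M. partial i (transition c d k) (chart_map c x) * v c i))}"

definition coord_vector :: "('a, 'm) riemannian_scheme \<Rightarrow> 'a chart \<Rightarrow> nat \<Rightarrow> 'a \<Rightarrow> 'a tangent" where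
  "coord_vector M c i x =
     (\<lambda>d k. if d \<in> charts_at M x \<and> k < mdim M
            then partial i (transition c d k) (chart_map c x) else 0)"

definition lincomb :: "real \<Rightarrow> 'a tangent \<Rightarrow> real \<Rightarrow> 'a tangent \<Rightarrow> 'a tangent" where
  "lincomb a u b v = (\<lambda>c k. a * u c k + b * v c k)"

definition metric_coeff ::
  "('a, 'm) riemannian_scheme \<Rightarrow> 'a chart \<Rightarrow> nat \<Rightarrow> nat \<Rightarrow> (nat \<Rightarrow> real) \<Rightarrow> real" where
  "metric_coeff M c i j = (\<lambda>y. metric M (chart_inv c y)
     (coord_vector M c i (chart_inv c y)) (coord_vector M c j (chart_inv c y)))"

definition riemannian_manifold :: "('a, 'm) riemannian_scheme \<Rightarrow> bool" where
  "riemannian_manifold M \<longleftrightarrow>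
     smooth_manifold (mtop M) (mdim M) (atlas M) \<and>
     (\<forall>x\<in>topspace (mtop M). \<forall>u\<in>tangent_space M x. \<forall>v\<in>tangent_space M x.
        metric M x u v = metric M x v u \<and>
        (\<forall>w\<in>tangent_space M x. \<forall>a b.
           metric M x (lincomb a u b v) w = a * metric M x u w + b * metric M x v w) \<and>
        (u \<noteq> (\<lambda>c k. 0) \<longrightarrow> metric M x u u > 0)) \<and>
     (\<forall>c\<in>atlas M. \<forall>i<mdim M. \<forall>j<mdim M. smooth_on (mdim M) (chart_img c) (metric_coeff M c i j))"

definition inverse_matrix :: "nat \<Rightarrow> (nat \<Rightarrow> nat \<Rightarrow> real) \<Rightarrow> nat \<Rightarrow> nat \<Rightarrow> real" where
  "inverse_matrix n G = (THE B.
     (\<forall>i j. \<not> (i < n \<and> j < n) \<longrightarrow> B i j = 0) \<and>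
     (\<forall>i<n. \<forall>j<n. (\<Sum>l<n. B i l * G l j) = (if i = j then 1 else 0)))"

text \<open>\<open>christoffel M c k i j\<close> is \<open>\<Gamma>\<^sup>k\<^sub>i\<^sub>j\<close>, i.e.
  \<open>\<nabla>\<^bsub>\<partial>i\<^esub> \<partial>\<^sub>j = (\<Sum>k. \<Gamma>\<^sup>k\<^sub>i\<^sub>j \<partial>\<^sub>k)\<close> for the Levi-Civita connection.\<close>

definition christoffel ::
  "('a, 'm) riemannian_scheme \<Rightarrow> 'a chart \<Rightarrow> nat \<Rightarrow> nat \<Rightarrow> nat \<Rightarrow> (nat \<Rightarrow> real) \<Rightarrow> real" where
  "christoffel M c k i j = (\<lambda>y. 1/2 * (\<Sum>l<mdim M.
     inverse_matrix (mdim M) (\<lambda>p q. metric_coeff M c p q y) k l *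
     (partial i (metric_coeff M c j l) y + partial j (metric_coeff M c i l) y
      - partial l (metric_coeff M c i j) y)))"

text \<open>\<open>curvature_coeff M c l i j k\<close> is the \<open>\<partial>\<^sub>l\<close>-component of \<open>R(\<partial>\<^sub>i, \<partial>\<^sub>j) \<partial>\<^sub>k\<close>, where
  \<open>R(X, Y) Z = \<nabla>\<^sub>X \<nabla>\<^sub>Y Z - \<nabla>\<^sub>Y \<nabla>\<^sub>X Z - \<nabla>\<^bsub>[X, Y]\<^esub> Z\<close>. With this sign,
  \<open>\<langle>R(u, v) v, u\<rangle>\<close> is positive on round spheres.\<close>

definition curvature_coeff :: "('a, 'm) riemannian_scheme \<Rightarrow> 'a chart \<Rightarrow>
    nat \<Rightarrow> nat \<Rightarrow> nat \<Rightarrow> nat \<Rightarrow> (nat \<Rightarrow> real) \<Rightarrow> real" where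
  "curvature_coeff M c l i j k = (\<lambda>y.
     partial i (christoffel M c l j k) y - partial j (christoffel M c l i k) y +
     (\<Sum>m<mdim M. christoffel M c l i m y * christoffel M c m j k y
                - christoffel M c l j m y * christoffel M c m i k y))"

definition curvature_form :: "('a, 'm) riemannian_scheme \<Rightarrow> 'a chart \<Rightarrow> 'a \<Rightarrow>
    'a tangent \<Rightarrow> 'a tangent \<Rightarrow> real" where
  "curvature_form M c x u v =
     (\<Sum>p<mdim M. \<Sum>l<mdim M. \<Sum>i<mdim M. \<Sum>j<mdim M. \<Sum>k<mdim M.
        metric_coeff M c l p (chart_map c x) * curvature_coeff M c l i j k (chart_map c x)
        * u c i * v c j * v c k * u c p)"

definition plane_basis ::
  "('a, 'm) riemannian_scheme \<Rightarrow> 'a \<Rightarrow> 'a tangent \<Rightarrow> 'a tangent \<Rightarrow> 'a tangent set \<Rightarrow> bool" where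
  "plane_basis M x u v P \<longleftrightarrow>
     u \<in> tangent_space M x \<and> v \<in> tangent_space M x \<and>
     (\<forall>a b. lincomb a u b v = (\<lambda>c k. 0) \<longrightarrow> a = 0 \<and> b = 0) \<and>
     P = {lincomb a u b v | a b. True}"

definition tangent_plane :: "('a, 'm) riemannian_scheme \<Rightarrow> 'a \<Rightarrow> 'a tangent set \<Rightarrow> bool" where
  "tangent_plane M x P \<longleftrightarrow> (\<exists>u v. plane_basis M x u v P)"

text \<open>The quotient below does not depend on the chart or on the basis of the plane, so the
  description is well defined.\<close>

definition sectional_curvature :: "('a, 'm) riemannian_scheme \<Rightarrow> 'a \<Rightarrow> 'a tangent set \<Rightarrow> real" where
  "sectional_curvature M x P = (THE \<kappa>. \<exists>c\<in>charts_at M x. \<exists>u v. plane_basis M x u v P \<and>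
     \<kappa> = curvature_form M c x u v /
         (metric M x u u * metric M x v v - (metric M x u v)\<^sup>2))"

text \<open>The functions \<open>w k\<close> are the first derivatives of the coordinates of \<open>\<gamma>\<close> in the chart \<open>c\<close>;
  derivatives at the endpoints of the interval are one-sided.\<close>

definition geodesic :: "('a, 'm) riemannian_scheme \<Rightarrow> real \<Rightarrow> real \<Rightarrow> (real \<Rightarrow> 'a) \<Rightarrow> bool" where
  "geodesic M a b \<gamma> \<longleftrightarrow>
     continuous_map (top_of_set {a..b}) (mtop M) \<gamma> \<and>
     (\<forall>c\<in>atlas M. \<exists>w. \<forall>t\<in>{a..b}. \<gamma> t \<in> chart_dom c \<longrightarrow> (\<forall>k<mdim M.
        ((\<lambda>s. chart_map c (\<gamma> s) k) has_real_derivative w k t) (at t within {a..b}) \<and>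
        (w k has_real_derivative
           - (\<Sum>i<mdim M. \<Sum>j<mdim M.
                christoffel M c k i j (chart_map c (\<gamma> t)) * w i t * w j t)) (at t within {a..b})))"

definition strictly_convex :: "('a, 'm) riemannian_scheme \<Rightarrow> ('a \<Rightarrow> real) \<Rightarrow> bool" where
  "strictly_convex M f \<longleftrightarrow>
     (\<forall>a b \<gamma>. a < b \<longrightarrow> geodesic M a b \<gamma> \<longrightarrow> \<not> \<gamma> constant_on {a..b} \<longrightarrow>
        (\<forall>t. 0 < t \<and> t < 1 \<longrightarrow>
           f (\<gamma> ((1 - t) * a + t * b)) < (1 - t) * f (\<gamma> a) + t * f (\<gamma> b)))"

end

(* On the half plane x > 0 take the warped product metric dx^2 + G(x) dy^2 with G = x + x^3 and
   the function f = x^2. Because G' > 0, along a geodesic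
   f'' = 2 x'^2 + x G'(x) y'^2 > 0 wherever the velocity is nonzero, and by conservation of energy
   the velocity of a nonconstant geodesic never vanishes. The Gauss curvature is
   G'^2 / (4 G^2) - G'' / (2 G), which tends to infinity as x tends to 0 and equals -1/2 at x = 1,
   so it takes every value above -1/2 by continuity. *)
theory Submission
  imports Defs "HOL-Real_Asymp.Real_Asymp"
begin

section \<open>The half plane, the profile function and the warped metric\<close>

definition half_plane :: "(nat \<Rightarrow> real) set" where
  "half_plane = {y. y 0 > 0 \<and> (\<forall>i\<ge>2. y i = 0)}"

text \<open>The linear term alone would give curvature 1/(4 x^2), which blows up at 0 but stays
  positive; the cubic term brings in negative values, such as -1/2 at x = 1.\<close>

definition profile :: "real \<Rightarrow> real" where
  "profile x = x + x ^ 3"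

definition profile' :: "real \<Rightarrow> real" where
  "profile' x = 1 + 3 * x\<^sup>2"

text \<open>This is the Gauss curvature -h''/h of dx^2 + h^2 dy^2 with h = sqrt G, rewritten through
  G = \<open>profile\<close>; the term \<open>6 * x\<close> is G''.\<close>

definition gauss_curv :: "real \<Rightarrow> real" where
  "gauss_curv x = (profile' x)\<^sup>2 / (4 * (profile x)\<^sup>2) - 6 * x / (2 * profile x)"

text \<open>A single global chart given by the identity makes the only transition map the
  identity.\<close>

definition hchart :: "(nat \<Rightarrow> real) chart" where
  "hchart = (half_plane, \<lambda>y. y)"

definition warped :: "(nat \<Rightarrow> real) riemannian" where
  "warped = \<lparr>mtop = top_of_set half_plane, mdim = 2, atlas = {hchart},
     metric = (\<lambda>x u v. u hchart 0 * v hchart 0 + profile (x 0) * u hchart 1 * v hchart 1)\<rparr>"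

lemma sum_lessThan_2: "(\<Sum>l<2::nat. f l) = f 0 + (f 1 :: 'a::comm_monoid_add)"
  by (simp add: numeral_2_eq_2)

lemma warped_simps [simp]:
  "mtop warped = top_of_set half_plane" "mdim warped = 2" "atlas warped = {hchart}"
  "metric warped x u v = u hchart 0 * v hchart 0 + profile (x 0) * u hchart 1 * v hchart 1"
  by (simp_all add: warped_def)

lemma hchart_simps [simp]: "chart_dom hchart = half_plane" "chart_map hchart = (\<lambda>y. y)"
  by (simp_all add: hchart_def)

lemma profile_pos: "x > 0 \<Longrightarrow> profile x > 0"
  by (simp add: profile_def add_pos_pos)

lemma profile'_pos: "profile' x > 0"
  by (simp add: profile'_def add_pos_nonneg)

lemma profile_deriv: "(profile has_real_derivative profile' x) (at x)"
  unfolding profile_def [abs_def] profile'_def by (auto intro!: derivative_eq_intros)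

lemma profile'_deriv: "(profile' has_real_derivative 6 * x) (at x)"
  unfolding profile'_def [abs_def] by (auto intro!: derivative_eq_intros)

lemma charts_at_warped [simp]: "x \<in> half_plane \<Longrightarrow> charts_at warped x = {hchart}"
  by (auto simp: charts_at_def)

lemma chart_inv_hchart [simp]: "y \<in> half_plane \<Longrightarrow> chart_inv hchart y = y"
  by (simp add: chart_inv_def inv_into_f_eq)

section \<open>Topology and partial derivatives on the half plane\<close>

lemma Euclidean_space_half_plane:
  "subtopology (Euclidean_space 2) half_plane = top_of_set half_plane"
proof -
  have "{x. \<forall>i\<ge>2. x i = 0} \<inter> half_plane = half_plane"
    by (auto simp: half_plane_def)
  then show ?thesis
    by (simp add: Euclidean_space_def euclidean_product_topology subtopology_subtopology)
qed

text \<open>The form g(x) + a y covers every function differentiated below: metric coefficients and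
  Christoffel symbols depend on x alone, and the coordinates are the cases g = id, a = 0 and g = 0,
  a = 1. Agreement is assumed only on the half plane, where the geometric functions are
  known.\<close>

lemma half_plane_derivative:
  assumes "y \<in> half_plane"
    and f: "\<And>z. z \<in> half_plane \<Longrightarrow> f z = g (z 0) + a * z 1"
    and g: "(g has_real_derivative D) (at (y 0))"
  shows "((\<lambda>t. f (y(0 := t))) has_real_derivative D) (at (y 0))"
    and "((\<lambda>t. f (y(1 := t))) has_real_derivative a) (at (y 1))"
proof -
  have y: "y 0 > 0" "\<And>i. i \<ge> 2 \<Longrightarrow> y i = 0"
    using assms(1) by (auto simp: half_plane_def)
  have "((\<lambda>t. g t + a * y 1) has_real_derivative D) (at (y 0))"
    using g by (auto intro!: derivative_eq_intros)
  then show "((\<lambda>t. f (y(0 := t))) has_real_derivative D) (at (y 0))"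
    \<comment> \<open>Varying coordinate 0 stays in the half plane exactly for t > 0; varying
      coordinate 1, as done next, never leaves it.\<close>
    by (rule has_field_derivative_transform_within_open[where S = "{0<..}"])
       (use y in \<open>auto simp: f half_plane_def\<close>)
  have "((\<lambda>t. g (y 0) + a * t) has_real_derivative a) (at (y 1))"
    by (auto intro!: derivative_eq_intros)
  then show "((\<lambda>t. f (y(1 := t))) has_real_derivative a) (at (y 1))"
    by (rule has_field_derivative_transform_within_open[where S = UNIV])
       (use y in \<open>auto simp: f half_plane_def\<close>)
qed

lemma partial_half_plane:
  assumes "y \<in> half_plane" and "\<And>z. z \<in> half_plane \<Longrightarrow> f z = g (z 0) + a * z 1"
    and "(g has_real_derivative D) (at (y 0))"
  shows "partial 0 f y = D" and "partial 1 f y = a"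
  using half_plane_derivative[OF assms]
  by (simp_all add: partial_def DERIV_imp_deriv del: fun_upd_apply)

lemma partial_half_plane_cases:
  assumes "y \<in> half_plane" and "\<And>z. z \<in> half_plane \<Longrightarrow> f z = g (z 0)"
    and "(g has_real_derivative D) (at (y 0))" and "i < 2"
  shows "partial i f y = (if i = 0 then D else 0)"
  using partial_half_plane[of y f g 0 D] assms by (auto simp: less_2_cases_iff)

lemma continuous_on_half_plane:
  assumes "\<And>z. z \<in> half_plane \<Longrightarrow> f z = poly p (z 0) + a * z 1"
  shows "continuous_on half_plane f"
proof -
  have "continuous_on half_plane (\<lambda>z. poly p (z 0) + a * z 1)"
    by (intro continuous_intros continuous_on_subset[OF continuous_on_product_coordinates]) auto
  then show ?thesis
    using assms by (simp cong: continuous_on_cong)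
qed

text \<open>The class p(x) + a y with p a polynomial is closed under both partial derivatives, which
  give p' and the constant a. Hence the induction generalises over f, p and a.\<close>

lemma C_k_on_half_plane:
  assumes "\<And>z. z \<in> half_plane \<Longrightarrow> f z = poly p (z 0) + a * z 1"
  shows "C_k_on 2 k half_plane f"
  using assms
proof (induction k arbitrary: f p a)
  case (0 f p a)
  then show ?case
    using continuous_on_half_plane by (auto simp: Euclidean_space_half_plane)
next
  case (Suc k f p a)
  have "continuous_map (subtopology (Euclidean_space 2) half_plane) euclideanreal f"
    using continuous_on_half_plane[OF Suc.prems] by (auto simp: Euclidean_space_half_plane)
  moreover have "(\<lambda>t. f (y(i := t))) differentiable (at (y i))"
    if "i < 2" "y \<in> half_plane" for i y
    using half_plane_derivative[where g = "poly p", OF that(2) Suc.prems poly_DERIV] that(1)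
    by (auto simp: less_2_cases_iff real_differentiable_def simp del: fun_upd_apply)
  moreover have "C_k_on 2 k half_plane (partial i f)" if "i < 2" for i
  proof -
    note part = partial_half_plane[where g = "poly p", OF _ Suc.prems poly_DERIV]
    show ?thesis
    proof (cases "i = 0")
      case True
      show ?thesis
        by (rule Suc.IH[of _ "pderiv p" 0]) (simp add: True part)
    next
      case False
      then have "i = 1" using that by simp
      then show ?thesis
        by (intro Suc.IH[of _ "[:a:]" 0]) (simp add: part[unfolded One_nat_def])
    qed
  qed
  ultimately show ?case by simp
qed

lemma smooth_on_half_plane:
  assumes "\<And>z. z \<in> half_plane \<Longrightarrow> f z = poly p (z 0) + a * z 1"
  shows "smooth_on 2 half_plane f"
  using C_k_on_half_plane[OF assms] by (simp add: smooth_on_def)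

section \<open>Coordinate frame, metric coefficients and Christoffel symbols\<close>

lemma transition_hchart: "y \<in> half_plane \<Longrightarrow> transition hchart hchart k y = y k"
  by (simp add: transition_def)

lemma partial_transition:
  assumes "y \<in> half_plane" "i < 2" "k < 2"
  shows "partial i (transition hchart hchart k) y = (if i = k then 1 else 0)"
proof (cases "k = 0")
  case True
  then show ?thesis
    using partial_half_plane[OF assms(1), of "transition hchart hchart k" "\<lambda>x. x" 0 1] assms
    by (auto simp: transition_hchart less_2_cases_iff)
next
  case False
  then show ?thesis
    using partial_half_plane[OF assms(1), of "transition hchart hchart k" "\<lambda>x. 0" 1 0] assms
    by (auto simp: transition_hchart less_2_cases_iff)
qed

lemma coord_vector_warped:
  assumes "x \<in> half_plane" "i < 2"
  shows "coord_vector warped hchart i x = (\<lambda>d k. if d = hchart \<and> k = i then 1 else 0)"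
  using assms by (auto simp: coord_vector_def partial_transition fun_eq_iff)

lemma metric_coeff_warped:
  assumes "y \<in> half_plane" "i < 2" "j < 2"
  shows "metric_coeff warped hchart i j y = (if i = j then if i = 0 then 1 else profile (y 0) else 0)"
  using assms by (auto simp: metric_coeff_def coord_vector_warped less_2_cases_iff)

lemma partial_metric_coeff:
  assumes "y \<in> half_plane" "i < 2" "j < 2" "l < 2"
  shows "partial l (metric_coeff warped hchart i j) y =
     (if l = 0 \<and> i = 1 \<and> j = 1 then profile' (y 0) else 0)"
proof (cases "i = 1 \<and> j = 1")
  case True
  then show ?thesis
    using partial_half_plane_cases[of y "metric_coeff warped hchart i j" profile "profile' (y 0)" l]
      assms profile_deriv by (simp add: metric_coeff_warped)
next
  case False
  then show ?thesis
    using partial_half_plane_cases[of y "metric_coeff warped hchart i j"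
        "\<lambda>_. if i = j then 1 else 0" 0 l] assms
    by (auto simp: metric_coeff_warped less_2_cases_iff)
qed

text \<open>Diagonality reduces each equation for a left inverse to the single product
  \<open>B i j * G j j\<close>, so B is determined inside the block; outside it the entries are 0 by
  the convention in \<open>inverse_matrix\<close>.\<close>

lemma inverse_matrix_diag2:
  assumes "G 0 1 = 0" "G 1 0 = 0" "G 0 0 \<noteq> 0" "G 1 1 \<noteq> 0"
  shows "inverse_matrix 2 G = (\<lambda>i j. if i = j \<and> i < 2 then 1 / G i i else 0)"
  unfolding inverse_matrix_def
proof (rule the_equality)
  fix B :: "nat \<Rightarrow> nat \<Rightarrow> real"
  assume B: "(\<forall>i j. \<not> (i < 2 \<and> j < 2) \<longrightarrow> B i j = 0) \<and>
    (\<forall>i<2. \<forall>j<2. (\<Sum>l<2. B i l * G l j) = (if i = j then 1 else 0))"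
  show "B = (\<lambda>i j. if i = j \<and> i < 2 then 1 / G i i else 0)"
  proof (intro ext)
    fix i j
    show "B i j = (if i = j \<and> i < 2 then 1 / G i i else 0)"
    proof (cases "i < 2 \<and> j < 2")
      case True
      then have "(\<Sum>l<2. B i l * G l j) = (if i = j then 1 else 0)" "i = 0 \<or> i = 1" "j = 0 \<or> j = 1"
        using B by (auto simp: less_2_cases_iff)
      then show ?thesis
        using assms by (auto simp: sum_lessThan_2 field_simps)
    qed (use B in auto)
  qed
qed (use assms in \<open>auto simp: less_2_cases_iff sum_lessThan_2\<close>)

text \<open>Christoffel symbols of the warped metric as functions of x. For indices below 2 the test
  \<open>(i = 0) = (j = 0)\<close> means i = j, so only the mixed symbols survive for upper index
  1.\<close>

definition chris :: "nat \<Rightarrow> nat \<Rightarrow> nat \<Rightarrow> real \<Rightarrow> real" where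
  "chris k i j x =
     (if k = 0 then if i = 0 \<or> j = 0 then 0 else - profile' x / 2
      else if (i = 0) = (j = 0) then 0 else profile' x / (2 * profile x))"

text \<open>The x-derivatives of \<open>chris\<close>; \<open>- 3 * x\<close> arises as
  -G''/2.\<close>

definition chris' :: "nat \<Rightarrow> nat \<Rightarrow> nat \<Rightarrow> real \<Rightarrow> real" where
  "chris' k i j x =
     (if k = 0 then if i = 0 \<or> j = 0 then 0 else - 3 * x
      else if (i = 0) = (j = 0) then 0
      else (6 * x * profile x - (profile' x)\<^sup>2) / (2 * (profile x)\<^sup>2))"

lemma chris_deriv:
  assumes "x > 0"
  shows "(chris k i j has_real_derivative chris' k i j x) (at x)"
  unfolding chris_def [abs_def] chris'_def using profile_pos[OF assms]
  by (auto intro!: derivative_eq_intros profile_deriv profile'_deriv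
      simp: field_simps power2_eq_square)

lemma christoffel_warped:
  assumes "y \<in> half_plane" "k < 2" "i < 2" "j < 2"
  shows "christoffel warped hchart k i j y = chris k i j (y 0)"
proof -
  have pos: "profile (y 0) > 0"
    using assms(1) by (auto simp: half_plane_def profile_pos)
  have "inverse_matrix 2 (\<lambda>p q. metric_coeff warped hchart p q y) =
      (\<lambda>i j. if i = j \<and> i < 2 then 1 / metric_coeff warped hchart i i y else 0)"
    by (rule inverse_matrix_diag2) (use assms(1) pos in \<open>auto simp: metric_coeff_warped\<close>)
  then show ?thesis
    unfolding christoffel_def using assms pos
    by (auto simp: metric_coeff_warped partial_metric_coeff less_2_cases_iff sum_lessThan_2 chris_def)
qed

lemma partial_christoffel_warped:
  assumes "y \<in> half_plane" "k < 2" "i < 2" "j < 2" "l < 2"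
  shows "partial l (christoffel warped hchart k i j) y = (if l = 0 then chris' k i j (y 0) else 0)"
  by (rule partial_half_plane_cases[where g = "chris k i j"])
     (use assms in \<open>auto simp: christoffel_warped half_plane_def intro: chris_deriv\<close>)

section \<open>The curvature tensor\<close>

lemma chris_zero:
  "chris 0 0 j x = 0" "chris 0 i 0 x = 0" "chris 1 0 0 x = 0" "chris 1 1 1 x = 0"
  "chris' 0 0 j x = 0" "chris' 0 i 0 x = 0" "chris' 1 0 0 x = 0" "chris' 1 1 1 x = 0"
  by (simp_all add: chris_def chris'_def)

lemma chris_sym: "chris 1 1 0 x = chris 1 0 1 x" "chris' 1 1 0 x = chris' 1 0 1 x"
  by (simp_all add: chris_def chris'_def)

text \<open>The curvature formula is solved for the derivatives here, so that rewriting with these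
  equations cancels the quadratic terms. As \<open>chris 1 0 1\<close> is h'/h for h = sqrt G, the
  second identity is its Riccati equation.\<close>

lemma chris_deriv_eq:
  assumes "x > 0"
  shows "chris' 0 1 1 x = gauss_curv x * profile x + chris 0 1 1 x * chris 1 0 1 x"
    and "chris' 1 0 1 x = - gauss_curv x - chris 1 0 1 x * chris 1 0 1 x"
proof -
  have "profile x > 0" by (rule profile_pos[OF assms])
  then show "chris' 0 1 1 x = gauss_curv x * profile x + chris 0 1 1 x * chris 1 0 1 x"
    and "chris' 1 0 1 x = - gauss_curv x - chris 1 0 1 x * chris 1 0 1 x"
    by (simp_all add: chris_def chris'_def gauss_curv_def field_simps power2_eq_square)
qed

text \<open>In dimension two the tensor with l lowered is antisymmetric in i, j and in l, k, which
  leaves plus or minus K det g with det g = G. Raising l divides by 1 for l = 0 and by G for l = 1,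
  whence the factor. The proof checks all 16 index combinations.\<close>

lemma curvature_coeff_warped:
  assumes "y \<in> half_plane" "l < 2" "i < 2" "j < 2" "k < 2"
  shows "curvature_coeff warped hchart l i j k y =
     (if i = j \<or> l = k then 0
      else gauss_curv (y 0) * (if l = 0 then profile (y 0) else 1) * (if i = l then 1 else -1))"
proof -
  have "y 0 > 0"
    using assms(1) by (simp add: half_plane_def)
  note deriv_eqs = chris_deriv_eq[OF this]
  have "curvature_coeff warped hchart l i j k y =
      (if i = 0 then chris' l j k (y 0) else 0) - (if j = 0 then chris' l i k (y 0) else 0)
      + (chris l i 0 (y 0) * chris 0 j k (y 0) - chris l j 0 (y 0) * chris 0 i k (y 0))
      + (chris l i 1 (y 0) * chris 1 j k (y 0) - chris l j 1 (y 0) * chris 1 i k (y 0))"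
    using assms
    by (simp add: curvature_coeff_def christoffel_warped partial_christoffel_warped sum_lessThan_2)
  moreover have "l = 0 \<or> l = 1" "i = 0 \<or> i = 1" "j = 0 \<or> j = 1" "k = 0 \<or> k = 1"
    using assms by (simp_all add: less_2_cases_iff)
  ultimately show ?thesis
    by (elim disjE)
      (simp_all add: chris_zero[unfolded One_nat_def] chris_sym[unfolded One_nat_def]
        deriv_eqs[unfolded One_nat_def])
qed

text \<open>The factor after \<open>gauss_curv\<close> is the Gram determinant of u and v: det g
  times the squared coordinate determinant.\<close>

lemma curvature_form_warped:
  assumes x: "x \<in> half_plane"
  shows "curvature_form warped hchart x u v =
    gauss_curv (x 0) * (profile (x 0) * (u hchart 0 * v hchart 1 - u hchart 1 * v hchart 0)\<^sup>2)"
  using x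
  by (simp add: curvature_form_def curvature_coeff_warped metric_coeff_warped sum_lessThan_2)
     (simp add: algebra_simps power2_eq_square)

section \<open>The half plane as a Riemannian manifold\<close>

lemma smooth_manifold_half_plane: "smooth_manifold (top_of_set half_plane) 2 {hchart}"
proof -
  have "connected half_plane"
  proof -
    \<comment> \<open>Connectedness is carried over from the product of a half line and a line by
      padding pairs with zeros.\<close>
    let ?f = "\<lambda>(a, b) (i::nat). if i = 0 then a else if i = 1 then b else (0::real)"
    have "half_plane = ?f ` ({0<..} \<times> UNIV)"
    proof (intro subset_antisym subsetI)
      fix y assume "y \<in> half_plane"
      then show "y \<in> ?f ` ({0<..} \<times> UNIV)"
        by (intro image_eqI[of _ _ "(y 0, y 1)"]) (auto simp: half_plane_def fun_eq_iff)
    qed (auto simp: half_plane_def)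
    moreover have "continuous_on ({0<..} \<times> UNIV) ?f"
    proof (intro continuous_on_coordinatewise_then_product)
      fix i
      show "continuous_on ({0<..} \<times> UNIV) (\<lambda>x. ?f x i)"
        by (cases "i = 0"; cases "i = 1") (auto simp: case_prod_unfold intro!: continuous_intros)
    qed
    then have "connected (?f ` ({0<..} \<times> UNIV))"
      by (rule connected_continuous_image) (intro connected_Times connected_Ioi connected_UNIV)
    ultimately show ?thesis
      by (simp only:)
  qed
  moreover have "second_countable (top_of_set half_plane)"
  proof (rule second_countable_subtopology)
    obtain B :: "(nat \<Rightarrow> real) set set" where B: "countable B" "topological_basis B"
      using ex_countable_basis by blast
    then have "\<forall>V\<in>B. openin euclidean V"
      and "\<forall>U x. openin euclidean U \<and> x \<in> U \<longrightarrow> (\<exists>V\<in>B. x \<in> V \<and> V \<subseteq> U)"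
      by (auto simp: topological_basis_open elim: topological_basisE)
    with B(1) show "second_countable (euclidean :: (nat \<Rightarrow> real) topology)"
      unfolding second_countable_def by blast
  qed
  moreover have "openin (Euclidean_space 2) half_plane"
  proof -
    have "half_plane = {x. x 0 > 0} \<inter> {x. \<forall>i\<ge>2. x i = 0}"
      by (auto simp: half_plane_def)
    moreover have "open {x :: nat \<Rightarrow> real. x 0 > 0}"
      by (intro open_Collect_less continuous_on_const continuous_on_product_coordinates)
    ultimately show ?thesis
      by (auto simp: Euclidean_space_def euclidean_product_topology openin_subtopology)
  qed
  moreover have "smooth_on 2 half_plane (transition hchart hchart k)" if "k < 2" for k
    \<comment> \<open>Coordinate 0 is the polynomial x with a = 0, coordinate 1 the zero polynomial
      with a = 1.\<close>
    by (rule smooth_on_half_plane[of _ "if k = 0 then [:0, 1:] else 0" "if k = 0 then 0 else 1"])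
       (use that in \<open>auto simp: transition_hchart less_2_cases_iff\<close>)
  moreover have "homeomorphic_map (top_of_set half_plane) (top_of_set half_plane) (\<lambda>y. y)"
    using homeomorphic_map_id[of "top_of_set half_plane" "top_of_set half_plane"]
    by (simp add: id_def)
  ultimately show ?thesis
    by (auto simp: subtopology_subtopology smooth_manifold_def is_chart_def Hausdorff_space_subtopology
        connected_space_subtopology Euclidean_space_half_plane)
qed

text \<open>The encoding of tangent vectors pads with zeros, so a vector is determined by its
  entries 0 and 1 at \<open>hchart\<close>; questions of vanishing and independence thus concern two
  numbers.\<close>

lemma tangent_space_warped_zero:
  assumes "u \<in> tangent_space warped x" "x \<in> half_plane" "c \<noteq> hchart \<or> k \<ge> 2"
  shows "u c k = 0"
proof (cases "c = hchart")
  case True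
  with assms have "u c \<in> topspace (Euclidean_space 2)" "k \<ge> 2"
    by (simp_all add: tangent_space_def)
  then show ?thesis
    by (simp add: topspace_Euclidean_space)
next
  case False
  with assms show ?thesis
    by (simp add: tangent_space_def del: split_paired_All)
qed

lemma riemannian_manifold_warped: "riemannian_manifold warped"
proof -
  have "smooth_on 2 half_plane (metric_coeff warped hchart i j)" if "i < 2" "j < 2" for i j
    \<comment> \<open>The last polynomial is x + x^3, the \<open>profile\<close>.\<close>
    by (rule smooth_on_half_plane[of _ "if i \<noteq> j then 0 else if i = 0 then 1 else [:0, 1, 0, 1:]" 0])
       (use that in \<open>auto simp: metric_coeff_warped profile_def power3_eq_cube algebra_simps\<close>)
  moreover have "u hchart 0 * u hchart 0 + profile (x 0) * u hchart 1 * u hchart 1 > 0"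
    if x: "x \<in> half_plane" and u: "u \<in> tangent_space warped x" "u \<noteq> (\<lambda>c k. 0)" for x u
  proof -
    have pos: "profile (x 0) > 0"
      using x by (auto simp: half_plane_def profile_pos)
    have "u hchart 0 \<noteq> 0 \<or> u hchart 1 \<noteq> 0"
    proof (rule ccontr)
      assume *: "\<not> ?thesis"
      have "u c k = 0" for c k
        using tangent_space_warped_zero[OF u(1) x, of c k] *
        by (cases "c = hchart \<and> k < 2") (auto simp: less_2_cases_iff not_less)
      then show False using u(2) by blast
    qed
    then have "(u hchart 0)\<^sup>2 + profile (x 0) * (u hchart 1)\<^sup>2 > 0"
      using pos by (auto intro: add_pos_nonneg add_nonneg_pos)
    then show ?thesis
      by (simp add: power2_eq_square mult.assoc)
  qed
  ultimately show ?thesis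
    by (auto simp: riemannian_manifold_def smooth_manifold_half_plane lincomb_def algebra_simps)
qed

section \<open>Sectional curvature and its range\<close>

lemma sectional_curvature_warped:
  assumes x: "x \<in> half_plane" and P: "tangent_plane warped x P"
  shows "sectional_curvature warped x P = gauss_curv (x 0)"
proof -
  have pos: "profile (x 0) > 0"
    using x by (auto simp: half_plane_def profile_pos)
  \<comment> \<open>Every basis of the plane gives the same quotient, which provides the uniqueness
    that the definite description demands.\<close>
  have quotient: "curvature_form warped hchart x u v /
      (metric warped x u u * metric warped x v v - (metric warped x u v)\<^sup>2) = gauss_curv (x 0)"
    if uv: "plane_basis warped x u v P" for u v
  proof -
    let ?D = "u hchart 0 * v hchart 1 - u hchart 1 * v hchart 0"
    have mem: "u \<in> tangent_space warped x" "v \<in> tangent_space warped x"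
      and indep: "\<And>a b. lincomb a u b v = (\<lambda>c k. 0) \<Longrightarrow> a = 0 \<and> b = 0"
      using uv by (auto simp: plane_basis_def)
    have eqI: "lincomb a u b v = (\<lambda>c k. 0)"
      if "a * u hchart 0 + b * v hchart 0 = 0" "a * u hchart 1 + b * v hchart 1 = 0" for a b
    proof (intro ext)
      fix c and k :: nat
      consider "c \<noteq> hchart \<or> k \<ge> 2" | "c = hchart" "k = 0" | "c = hchart" "k = 1"
        by linarith
      then show "lincomb a u b v c k = 0"
        by cases (use that tangent_space_warped_zero[OF mem(1) x]
          tangent_space_warped_zero[OF mem(2) x] in \<open>auto simp: lincomb_def\<close>)
    qed
    \<comment> \<open>If the determinant vanished, the coefficient pairs (v0, -u0) and (v1, -u1)
      would give zero combinations. Independence would then force all four coordinates to be 0,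
      making u itself zero.\<close>
    have "?D \<noteq> 0"
    proof
      assume D: "?D = 0"
      have "v hchart 0 = 0" "u hchart 0 = 0"
        using indep[OF eqI[of "v hchart 0" "- u hchart 0"]] D by (auto simp: algebra_simps)
      moreover have "v hchart 1 = 0" "u hchart 1 = 0"
        using indep[OF eqI[of "v hchart 1" "- u hchart 1"]] D by (auto simp: algebra_simps)
      ultimately show False
        using indep[OF eqI[of 1 0]] by simp
    qed
    moreover have "metric warped x u u * metric warped x v v - (metric warped x u v)\<^sup>2
        = profile (x 0) * ?D\<^sup>2"
      by (simp add: algebra_simps power2_eq_square)
    ultimately show ?thesis
      using pos curvature_form_warped[OF x] by simp
  qed
  obtain u v where "plane_basis warped x u v P"
    using P by (auto simp: tangent_plane_def)
  then show ?thesis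
    unfolding sectional_curvature_def
    by (intro the_equality) (use x quotient in \<open>fastforce simp del: warped_simps\<close>)+
qed

lemma tangent_plane_warped_exists:
  assumes x: "x \<in> half_plane"
  shows "\<exists>P. tangent_plane warped x P"
proof -
  let ?e = "\<lambda>i. coord_vector warped hchart i x"
  have "?e i \<in> tangent_space warped x" if "i < 2" for i
    using that x
    by (auto simp: tangent_space_def coord_vector_warped topspace_Euclidean_space
        partial_transition sum_lessThan_2 less_2_cases_iff)
  moreover have "a = 0 \<and> b = 0" if "lincomb a (?e 0) b (?e 1) = (\<lambda>c k. 0)" for a b
    using fun_cong[OF fun_cong[OF that], of hchart 0] fun_cong[OF fun_cong[OF that], of hchart 1]
    by (simp add: lincomb_def coord_vector_warped x)
  ultimately have "plane_basis warped x (?e 0) (?e 1) {lincomb a (?e 0) b (?e 1) | a b. True}"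
    by (simp add: plane_basis_def)
  then show ?thesis
    unfolding tangent_plane_def by blast
qed

lemma gauss_curv_attained:
  assumes "\<kappa> > -1/2"
  shows "\<exists>x>0. gauss_curv x = \<kappa>"
proof -
  have cont: "continuous_on {0<..} gauss_curv"
    unfolding gauss_curv_def [abs_def] using profile_pos
    by (intro continuous_intros continuous_at_imp_continuous_on ballI)
       (auto intro: DERIV_isCont[OF profile_deriv] DERIV_isCont[OF profile'_deriv]
         simp: less_imp_neq[symmetric])
  have "gauss_curv 1 = -1/2"
    by (simp add: gauss_curv_def profile_def profile'_def)
  \<comment> \<open>The first term grows like 1/(4 x^2) while the second tends to 3.\<close>
  moreover have "filterlim gauss_curv at_top (at_right 0)"
    unfolding gauss_curv_def [abs_def] profile_def profile'_def by real_asymp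
  then have "eventually (\<lambda>x. gauss_curv x \<ge> \<kappa> \<and> 0 < x \<and> x < 1) (at_right 0)"
    using eventually_at_right_real[of 0 "1::real"]
    by (auto simp: filterlim_at_top elim: eventually_elim2)
  then obtain x where "gauss_curv x \<ge> \<kappa>" "0 < x" "x < 1"
    using eventually_happens'[OF trivial_limit_at_right_real] by fastforce
  moreover from \<open>0 < x\<close> have "continuous_on {x..1} gauss_curv"
    by (auto intro: continuous_on_subset[OF cont])
  \<comment> \<open>The values at x and 1 enclose \<kappa>, so the intermediate value theorem
    applies without any monotonicity.\<close>
  ultimately obtain z where "x \<le> z" "gauss_curv z = \<kappa>"
    using IVT2'[of gauss_curv 1 \<kappa> x] assms by auto
  with \<open>0 < x\<close> show ?thesis by (auto intro!: exI[of _ z])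
qed

section \<open>Strict convexity along geodesics\<close>

lemma strictly_less_chord:
  fixes F F' :: "real \<Rightarrow> real"
  assumes "a < b" "0 < t" "t < 1"
    and F: "\<And>s. s \<in> {a..b} \<Longrightarrow> (F has_real_derivative F' s) (at s within {a..b})"
    and mono: "\<And>r s. \<lbrakk>r \<in> {a..b}; s \<in> {a..b}; r < s\<rbrakk> \<Longrightarrow> F' r < F' s"
  shows "F ((1 - t) * a + t * b) < (1 - t) * F a + t * F b"
proof -
  define m where "m = (1 - t) * a + t * b"
  have am: "m - a = t * (b - a)" and mb: "b - m = (1 - t) * (b - a)"
    by (simp_all add: m_def algebra_simps)
  then have "a < m" "m < b"
    using assms(1-3) by (smt (verit) mult_pos_pos)+
  \<comment> \<open>The mean slopes on the two sides of m are values of F' at points z1 < m < z2, so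
    strict monotonicity of F' makes the right slope larger.\<close>
  have mvt: "\<exists>z. p < z \<and> z < q \<and> F q - F p = (q - p) * F' z" if "a \<le> p" "p < q" "q \<le> b" for p q
  proof -
    have "(F has_derivative (\<lambda>h. h * F' s)) (at s within {p..q})" if "p \<le> s" "s \<le> q" for s
    proof -
      have "(F has_real_derivative F' s) (at s within {p..q})"
        by (rule DERIV_subset[OF F]) (use that \<open>a \<le> p\<close> \<open>q \<le> b\<close> in auto)
      then show ?thesis
        by (simp add: has_field_derivative_def mult_commute_abs)
    qed
    then show ?thesis
      using mvt_simple[OF \<open>p < q\<close>, of F "\<lambda>s h. h * F' s"] by (auto simp: greaterThanLessThan_iff)
  qed
  obtain z1 where z1: "a < z1" "z1 < m" "F m - F a = (m - a) * F' z1"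
    using mvt[of a m] \<open>a < m\<close> \<open>m < b\<close> by auto
  obtain z2 where z2: "m < z2" "z2 < b" "F b - F m = (b - m) * F' z2"
    using mvt[of m b] \<open>a < m\<close> \<open>m < b\<close> by auto
  have "(1 - t) * F a + t * F b - F m = t * (F b - F m) - (1 - t) * (F m - F a)"
    by (simp add: algebra_simps)
  also have "\<dots> = t * (1 - t) * (b - a) * (F' z2 - F' z1)"
    unfolding z1 z2 am mb by (simp add: algebra_simps)
  also have "\<dots> > 0"
    using assms(1-3) mono[of z1 z2] z1 z2 by simp
  finally show ?thesis
    by (simp add: m_def)
qed

lemma strictly_convex_warped: "strictly_convex warped (\<lambda>y. (y 0)\<^sup>2)"
  unfolding strictly_convex_def
proof (intro allI impI)
  fix a b t :: real and \<gamma>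
  assume "a < b" and geo: "geodesic warped a b \<gamma>" and nonconst: "\<not> \<gamma> constant_on {a..b}"
    and t: "0 < t \<and> t < 1"
  let ?I = "{a..b}"
  have in_H: "\<gamma> s \<in> half_plane" if "s \<in> ?I" for s
    using geo that by (auto simp: geodesic_def continuous_map_def)
  \<comment> \<open>The only chart contains the whole curve, so one pair of velocity functions
    serves on the entire interval.\<close>
  obtain w where "\<forall>s\<in>?I. \<gamma> s \<in> half_plane \<longrightarrow> (\<forall>k<2.
      ((\<lambda>s. \<gamma> s k) has_real_derivative w k s) (at s within ?I) \<and>
      (w k has_real_derivative
        - (\<Sum>i<2. \<Sum>j<2. christoffel warped hchart k i j (\<gamma> s) * w i s * w j s))
        (at s within ?I))"
    using geo unfolding geodesic_def by (auto simp del: atLeastAtMost_iff)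
  with in_H have w: "\<And>s k. \<lbrakk>s \<in> ?I; k < 2\<rbrakk> \<Longrightarrow>
      ((\<lambda>s. \<gamma> s k) has_real_derivative w k s) (at s within ?I) \<and>
      (w k has_real_derivative
        - (\<Sum>i<2. \<Sum>j<2. christoffel warped hchart k i j (\<gamma> s) * w i s * w j s))
        (at s within ?I)"
    by blast
  define x where "x s = \<gamma> s 0" for s
  have x_pos: "x s > 0" if "s \<in> ?I" for s
    using in_H[OF that] by (simp add: half_plane_def x_def)
  have x: "(x has_real_derivative w 0 s) (at s within ?I)"
    and y: "((\<lambda>s. \<gamma> s 1) has_real_derivative w 1 s) (at s within ?I)" if "s \<in> ?I" for s
    using w[OF that, of 0] w[OF that, of 1] by (simp_all add: x_def [abs_def])
  have w0: "(w 0 has_real_derivative profile' (x s) / 2 * (w 1 s)\<^sup>2) (at s within ?I)"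
    if "s \<in> ?I" for s
    using w[OF that, of 0] in_H[OF that]
    by (simp add: christoffel_warped sum_lessThan_2 chris_def x_def power2_eq_square mult.assoc)
  \<comment> \<open>The two equal mixed symbols G'/(2G) add up to G'/G.\<close>
  have w1: "(w 1 has_real_derivative - (profile' (x s) / profile (x s) * w 0 s * w 1 s)) (at s within ?I)"
    if "s \<in> ?I" for s
    using w[OF that, of 1] in_H[OF that] 
    by (simp add: christoffel_warped sum_lessThan_2 chris_def x_def algebra_simps)
  \<comment> \<open>The squared speed. In its derivative, x'' and G' each contribute G' x' y'^2, and
    y'' contributes -2 G' x' y'^2.\<close>
  define E where "E s = (w 0 s)\<^sup>2 + profile (x s) * (w 1 s)\<^sup>2" for s
  have "(E has_real_derivative 0) (at s within ?I)" if "s \<in> ?I" for s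
    unfolding E_def [abs_def] using profile_pos[OF x_pos[OF that]]
    by (auto intro!: derivative_eq_intros w0 w1[unfolded One_nat_def] x DERIV_chain2[OF profile_deriv] that
        simp: field_simps power2_eq_square)
  then obtain e where e: "\<And>s. s \<in> ?I \<Longrightarrow> E s = e"
    using has_field_derivative_zero_constant[of ?I E] by auto
  \<comment> \<open>One instant of zero velocity makes the conserved energy 0. As G > 0, both
    velocity components then vanish throughout and the curve is constant.\<close>
  have moving: "w 0 s \<noteq> 0 \<or> w 1 s \<noteq> 0" if s: "s \<in> ?I" for s
  proof (rule ccontr)
    assume "\<not> ?thesis"
    then have "e = 0" using e[OF s] by (simp add: E_def)
    have zero: "w 0 r = 0 \<and> w 1 r = 0" if "r \<in> ?I" for r
      using e[OF that] \<open>e = 0\<close> profile_pos[OF x_pos[OF that]]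
      by (auto simp: E_def add_nonneg_eq_0_iff)
    obtain c0 where c0: "\<And>r. r \<in> ?I \<Longrightarrow> \<gamma> r 0 = c0"
      using has_field_derivative_zero_constant[of ?I x] x zero by (auto simp: x_def)
    obtain c1 where c1: "\<And>r. r \<in> ?I \<Longrightarrow> \<gamma> r 1 = c1"
      using has_field_derivative_zero_constant[of ?I "\<lambda>s. \<gamma> s 1"] y zero by auto
    have "\<gamma> r = (\<lambda>k. if k = 0 then c0 else if k = 1 then c1 else 0)" if "r \<in> ?I" for r
      using c0[OF that] c1[OF that] in_H[OF that] by (auto simp: half_plane_def fun_eq_iff)
    then show False
      using nonconst unfolding constant_on_def by blast
  qed
  have "(x ((1 - t) * a + t * b))\<^sup>2 < (1 - t) * (x a)\<^sup>2 + t * (x b)\<^sup>2"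
  proof (rule strictly_less_chord[where F' = "\<lambda>s. 2 * x s * w 0 s"])
    fix s assume "s \<in> ?I"
    then show "((\<lambda>s. (x s)\<^sup>2) has_real_derivative 2 * x s * w 0 s) (at s within ?I)"
      by (auto intro!: derivative_eq_intros x)
  next
    fix p q assume pq: "p \<in> ?I" "q \<in> ?I" "p < q"
    \<comment> \<open>At p and q the derivative may be only one-sided, so monotonicity is drawn from
      continuity on the closed interval and a positive derivative on the open one.\<close>
    show "2 * x p * w 0 p < 2 * x q * w 0 q"
    proof (rule DERIV_pos_imp_increasing_open[OF \<open>p < q\<close>])
      \<comment> \<open>Inserting x'' = G' y'^2 / 2 turns 2 x'^2 + 2 x x'' into the stated
        expression.\<close>
      have deriv: "((\<lambda>s. 2 * x s * w 0 s) has_real_derivative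
          2 * (w 0 s)\<^sup>2 + x s * profile' (x s) * (w 1 s)\<^sup>2) (at s within ?I)" if "s \<in> ?I" for s
        by (auto intro!: derivative_eq_intros x w0 that simp: power2_eq_square)
      show "continuous_on {p..q} (\<lambda>s. 2 * x s * w 0 s)"
        by (rule continuous_on_subset[OF DERIV_continuous_on[OF deriv]]) (use pq in auto)
      fix s assume "p < s" "s < q"
      with pq have s: "s \<in> ?I" and "s \<in> interior ?I" by auto
      then have "((\<lambda>s. 2 * x s * w 0 s) has_real_derivative
          2 * (w 0 s)\<^sup>2 + x s * profile' (x s) * (w 1 s)\<^sup>2) (at s)"
        using deriv[OF s] by (metis at_within_interior)
      moreover have "2 * (w 0 s)\<^sup>2 + x s * profile' (x s) * (w 1 s)\<^sup>2 > 0"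
        using moving[OF s] x_pos[OF s] profile'_pos[of "x s"]
        by (auto intro: add_pos_nonneg add_nonneg_pos)
      ultimately show "\<exists>d. ((\<lambda>s. 2 * x s * w 0 s) has_real_derivative d) (at s) \<and> d > 0"
        by blast
    qed
  qed (use \<open>a < b\<close> t in auto)
  then show "(\<gamma> ((1 - t) * a + t * b) 0)\<^sup>2 < (1 - t) * (\<gamma> a 0)\<^sup>2 + t * (\<gamma> b 0)\<^sup>2"
    by (simp add: x_def)
qed

theorem corollary1:
  shows "\<exists>(M :: (nat \<Rightarrow> real) riemannian) (c::real).
    riemannian_manifold M \<and> c < 0 \<and>
    (\<forall>\<kappa>>c. \<exists>x\<in>topspace (mtop M). \<exists>P. tangent_plane M x P \<and> sectional_curvature M x P = \<kappa>) \<and>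
    (\<exists>f :: (nat \<Rightarrow> real) \<Rightarrow> real. strictly_convex M f)"
proof (intro exI[of _ warped] exI[of _ "-1/2"] conjI allI impI)
  fix \<kappa> :: real assume "\<kappa> > -1/2"
  then obtain x where "x > 0" "gauss_curv x = \<kappa>"
    using gauss_curv_attained by blast
  \<comment> \<open>The curvature depends on coordinate 0 alone, so coordinate 1 is simply set to
    0.\<close>
  define y where "y = (\<lambda>i::nat. if i = 0 then x else 0)"
  have y: "y \<in> half_plane"
    using \<open>x > 0\<close> by (simp add: y_def half_plane_def)
  then obtain P where "tangent_plane warped y P"
    using tangent_plane_warped_exists by blast
  moreover from this have "sectional_curvature warped y P = \<kappa>"
    using sectional_curvature_warped[OF y] \<open>gauss_curv x = \<kappa>\<close> by (simp add: y_def)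
  ultimately show "\<exists>y\<in>topspace (mtop warped). \<exists>P. tangent_plane warped y P \<and>
      sectional_curvature warped y P = \<kappa>"
    using y by auto
next
  show "\<exists>f. strictly_convex warped f"
    using strictly_convex_warped by blast
qed (simp_all add: riemannian_manifold_warped)

end
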